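(* Let $r\ge 3$ be a real number and let $T$ be a theory. The following conditions are equivalent: (1) For every definable relation $R(x_1,x_2)$ with a sequence $\{a_i\}_{i<\omega}$ such that $\models R(a_i,a_j)$ for all $i<j$, for all integers $N<\omega$ there are $b_0,\ldots,b_{N-1}$ such that $\models R(b_i,b_{(i+j)\bmod N})$ for $0\le i<N$, $1\le j\le\frac{N}{r}$. (1$'$) For every definable relation $R(x_1,x_2)$ with a sequence $\{a_i\}_{i<\omega}$ such that $\models R(a_i,a_j)$ for all $i<j$, for all sufficiently large integers $N<\omega$ there are $b_0,\ldots,b_{N-1}$ such that $\models R(b_i,b_{(i+j)\bmod N})$ for $0\le i<N$, $1\le j\le\frac{N}{r}$. (2) For every definable relation $R(x_1,x_2)$ with a sequence $\{a_i\}_{i<\omega}$ such that $\models R(a_i,a_j)$ for all $i<j$, there exists a set $\{a_\theta\}_{\theta\in S^1}$, indexed by the unit circle $S^1$, such that $\models R(a_\theta,a_\psi)$ for all $\theta\ne\psi$ in $S^1$ with $\psi$ lying at most $\frac{2\pi}{r}$ radians counterclockwise from $\theta$.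
   Context: $T$ is a (complete) first-order theory; $\models$ and all elements refer to a sufficiently saturated (monster) model of $T$; in a definable relation $R(x_1,x_2)$, $x_1,x_2$ are finite tuples of variables of the same length, and the $a_i,b_i,a_\theta$ are tuples of that length. "$\psi\neq\theta$ lies at most $\frac{2\pi}{r}$ radians counterclockwise from $\theta$" means that the counterclockwise angle from $\theta$ to $\psi$ lies in $(0,\frac{2\pi}{r}]$. *)

theory Defs
  imports "HOL-Analysis.Complex_Transcendental"
begin

unbundle cardinal_syntax

section \<open>First-order languages, structures and theories\<close>

text \<open>
  A language is given by its function and relation symbols, each paired with its arity;
  constants are function symbols of arity 0. Since symbols form sets, either kind may be empty.
\<close>

record ('f, 'p) lang =
  fun_syms :: "('f \<times> nat) set"
  rel_syms :: "('p \<times> nat) set"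

datatype 'f tm = Var nat | App 'f "'f tm list"

datatype ('f, 'p) fm =
    Falsum
  | Eql "'f tm" "'f tm"
  | Rel 'p "'f tm list"
  | Imp "('f, 'p) fm" "('f, 'p) fm"
  | All nat "('f, 'p) fm"

abbreviation Neg :: "('f, 'p) fm \<Rightarrow> ('f, 'p) fm" where
  "Neg \<phi> \<equiv> Imp \<phi> Falsum"

fun wf_tm :: "('f, 'p) lang \<Rightarrow> 'f tm \<Rightarrow> bool" where
  "wf_tm L (Var x) \<longleftrightarrow> True"
| "wf_tm L (App f ts) \<longleftrightarrow> (f, length ts) \<in> fun_syms L \<and> (\<forall>t\<in>set ts. wf_tm L t)"

fun wf_fm :: "('f, 'p) lang \<Rightarrow> ('f, 'p) fm \<Rightarrow> bool" where
  "wf_fm L Falsum \<longleftrightarrow> True"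
| "wf_fm L (Eql s t) \<longleftrightarrow> wf_tm L s \<and> wf_tm L t"
| "wf_fm L (Rel p ts) \<longleftrightarrow> (p, length ts) \<in> rel_syms L \<and> (\<forall>t\<in>set ts. wf_tm L t)"
| "wf_fm L (Imp \<phi> \<psi>) \<longleftrightarrow> wf_fm L \<phi> \<and> wf_fm L \<psi>"
| "wf_fm L (All x \<phi>) \<longleftrightarrow> wf_fm L \<phi>"

fun fv_tm :: "'f tm \<Rightarrow> nat set" where
  "fv_tm (Var x) = {x}"
| "fv_tm (App f ts) = (\<Union>t\<in>set ts. fv_tm t)"

fun fv :: "('f, 'p) fm \<Rightarrow> nat set" where
  "fv Falsum = {}"
| "fv (Eql s t) = fv_tm s \<union> fv_tm t"
| "fv (Rel p ts) = (\<Union>t\<in>set ts. fv_tm t)"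
| "fv (Imp \<phi> \<psi>) = fv \<phi> \<union> fv \<psi>"
| "fv (All x \<phi>) = fv \<phi> - {x}"

definition sentence :: "('f, 'p) lang \<Rightarrow> ('f, 'p) fm \<Rightarrow> bool" where
  "sentence L \<phi> \<longleftrightarrow> wf_fm L \<phi> \<and> fv \<phi> = {}"

record ('f, 'p, 'a) struct =
  univ :: "'a set"
  fun_int :: "'f \<Rightarrow> 'a list \<Rightarrow> 'a"
  rel_int :: "'p \<Rightarrow> 'a list \<Rightarrow> bool"

definition tuples :: "('f, 'p, 'a) struct \<Rightarrow> nat \<Rightarrow> 'a list set" where
  "tuples M n = {xs. length xs = n \<and> set xs \<subseteq> univ M}"

definition is_struct :: "('f, 'p) lang \<Rightarrow> ('f, 'p, 'a) struct \<Rightarrow> bool" where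
  "is_struct L M \<longleftrightarrow> univ M \<noteq> {} \<and>
     (\<forall>(f, n)\<in>fun_syms L. \<forall>xs\<in>tuples M n. fun_int M f xs \<in> univ M)"

fun eval_tm :: "('f, 'p, 'a) struct \<Rightarrow> (nat \<Rightarrow> 'a) \<Rightarrow> 'f tm \<Rightarrow> 'a" where
  "eval_tm M v (Var x) = v x"
| "eval_tm M v (App f ts) = fun_int M f (map (eval_tm M v) ts)"

fun sat :: "('f, 'p, 'a) struct \<Rightarrow> (nat \<Rightarrow> 'a) \<Rightarrow> ('f, 'p) fm \<Rightarrow> bool" where
  "sat M v Falsum \<longleftrightarrow> False"
| "sat M v (Eql s t) \<longleftrightarrow> eval_tm M v s = eval_tm M v t"
| "sat M v (Rel p ts) \<longleftrightarrow> rel_int M p (map (eval_tm M v) ts)"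
| "sat M v (Imp \<phi> \<psi>) \<longleftrightarrow> (sat M v \<phi> \<longrightarrow> sat M v \<psi>)"
| "sat M v (All x \<phi>) \<longleftrightarrow> (\<forall>a\<in>univ M. sat M (v(x := a)) \<phi>)"

definition is_model :: "('f, 'p) lang \<Rightarrow> ('f, 'p, 'a) struct \<Rightarrow> ('f, 'p) fm set \<Rightarrow> bool" where
  "is_model L M T \<longleftrightarrow> is_struct L M \<and>
     (\<forall>\<phi>\<in>T. \<forall>v. range v \<subseteq> univ M \<longrightarrow> sat M v \<phi>)"

definition is_theory :: "('f, 'p) lang \<Rightarrow> ('f, 'p) fm set \<Rightarrow> bool" where
  "is_theory L T \<longleftrightarrow> (\<forall>\<phi>\<in>T. sentence L \<phi>)"

text \<open>
  HOL cannot quantify over all structures on all types. Structures whose universe is a set of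
  formulas suffice: the type of formulas is infinite and has at least as many elements as there
  are symbols, so by the downward Loewenheim-Skolem theorem every satisfiable set of sentences
  has such a model, and the relation below is semantic consequence in the usual sense.
\<close>

definition entails :: "('f, 'p) lang \<Rightarrow> ('f, 'p) fm set \<Rightarrow> ('f, 'p) fm \<Rightarrow> bool" where
  "entails L T \<phi> \<longleftrightarrow>
     (\<forall>M :: ('f, 'p, ('f, 'p) fm) struct. is_model L M T \<longrightarrow> is_model L M {\<phi>})"

definition complete_theory :: "('f, 'p) lang \<Rightarrow> ('f, 'p) fm set \<Rightarrow> bool" where
  "complete_theory L T \<longleftrightarrow> is_theory L T \<and>
     (\<forall>\<phi>. sentence L \<phi> \<longrightarrow> entails L T \<phi> \<or> entails L T (Neg \<phi>))"


section \<open>Definable relations and saturation\<close>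

text \<open>
  The assignment sending variable \<open>i\<close> to the \<open>i\<close>-th entry of a list. It is only used with
  formulas whose free variables lie below the length of the list.
\<close>

definition env :: "'a list \<Rightarrow> nat \<Rightarrow> 'a" where
  "env xs i = xs ! i"

text \<open>
  As is customary, definable means definable with parameters \<open>cs\<close> from the model.
\<close>

definition definable_rel ::
  "('f, 'p) lang \<Rightarrow> ('f, 'p, 'a) struct \<Rightarrow> nat \<Rightarrow> ('a list \<Rightarrow> 'a list \<Rightarrow> bool) \<Rightarrow> bool" where
  "definable_rel L M n R \<longleftrightarrow>
     (\<exists>\<phi> cs. wf_fm L \<phi> \<and> set cs \<subseteq> univ M \<and> fv \<phi> \<subseteq> {..<n + n + length cs} \<and>
        (\<forall>a\<in>tuples M n. \<forall>b\<in>tuples M n. R a b \<longleftrightarrow> sat M (env (a @ b @ cs)) \<phi>))"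

text \<open>
  A formula over \<open>A\<close> in one free variable is a pair of an \<open>L\<close>-formula and a list of parameters
  from \<open>A\<close>; variable 0 is the free variable and variables 1, 2, ... stand for the parameters.
\<close>

definition type_over ::
  "('f, 'p) lang \<Rightarrow> ('f, 'p, 'a) struct \<Rightarrow> 'a set \<Rightarrow> (('f, 'p) fm \<times> 'a list) set \<Rightarrow> bool" where
  "type_over L M A p \<longleftrightarrow>
     (\<forall>(\<phi>, cs)\<in>p. wf_fm L \<phi> \<and> set cs \<subseteq> A \<and> fv \<phi> \<subseteq> {..<1 + length cs}) \<and>
     (\<forall>q\<subseteq>p. finite q \<longrightarrow> (\<exists>a\<in>univ M. \<forall>(\<phi>, cs)\<in>q. sat M (env (a # cs)) \<phi>))"

definition saturated ::
  "('f, 'p) lang \<Rightarrow> ('f, 'p, 'a) struct \<Rightarrow> 'k rel \<Rightarrow> bool" where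
  "saturated L M \<kappa> \<longleftrightarrow>
     (\<forall>A p. A \<subseteq> univ M \<and> |A| <o \<kappa> \<and> type_over L M A p \<longrightarrow>
        (\<exists>a\<in>univ M. \<forall>(\<phi>, cs)\<in>p. sat M (env (a # cs)) \<phi>))"


section \<open>The three conditions\<close>

definition chain_rel ::
  "('f, 'p, 'a) struct \<Rightarrow> nat \<Rightarrow> ('a list \<Rightarrow> 'a list \<Rightarrow> bool) \<Rightarrow> bool" where
  "chain_rel M n R \<longleftrightarrow>
     (\<exists>a :: nat \<Rightarrow> 'a list. (\<forall>i. a i \<in> tuples M n) \<and> (\<forall>i j. i < j \<longrightarrow> R (a i) (a j)))"

definition cyclic_rel ::
  "('f, 'p, 'a) struct \<Rightarrow> nat \<Rightarrow> real \<Rightarrow> nat \<Rightarrow> ('a list \<Rightarrow> 'a list \<Rightarrow> bool) \<Rightarrow> bool" where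
  "cyclic_rel M n r N R \<longleftrightarrow>
     (\<exists>b :: nat \<Rightarrow> 'a list. (\<forall>i<N. b i \<in> tuples M n) \<and>
        (\<forall>i<N. \<forall>j. 1 \<le> j \<and> real j \<le> real N / r \<longrightarrow> R (b i) (b ((i + j) mod N))))"

definition ccw_angle :: "complex \<Rightarrow> complex \<Rightarrow> real" where
  "ccw_angle \<theta> \<psi> = Arg2pi (\<psi> / \<theta>)"

definition circle_rel ::
  "('f, 'p, 'a) struct \<Rightarrow> nat \<Rightarrow> real \<Rightarrow> ('a list \<Rightarrow> 'a list \<Rightarrow> bool) \<Rightarrow> bool" where
  "circle_rel M n r R \<longleftrightarrow>
     (\<exists>a :: complex \<Rightarrow> 'a list. (\<forall>\<theta>\<in>sphere 0 1. a \<theta> \<in> tuples M n) \<and>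
        (\<forall>\<theta>\<in>sphere 0 1. \<forall>\<psi>\<in>sphere 0 1.
           \<theta> \<noteq> \<psi> \<and> 0 < ccw_angle \<theta> \<psi> \<and> ccw_angle \<theta> \<psi> \<le> 2 * pi / r \<longrightarrow> R (a \<theta>) (a \<psi>)))"

definition cond_all_cycles :: "('f, 'p) lang \<Rightarrow> ('f, 'p, 'a) struct \<Rightarrow> real \<Rightarrow> bool" where
  "cond_all_cycles L M r \<longleftrightarrow>
     (\<forall>n R. definable_rel L M n R \<and> chain_rel M n R \<longrightarrow> (\<forall>N. cyclic_rel M n r N R))"

definition cond_large_cycles :: "('f, 'p) lang \<Rightarrow> ('f, 'p, 'a) struct \<Rightarrow> real \<Rightarrow> bool" where
  "cond_large_cycles L M r \<longleftrightarrow>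
     (\<forall>n R. definable_rel L M n R \<and> chain_rel M n R \<longrightarrow>
        (\<exists>N\<^sub>0. \<forall>N\<ge>N\<^sub>0. cyclic_rel M n r N R))"

definition cond_circle :: "('f, 'p) lang \<Rightarrow> ('f, 'p, 'a) struct \<Rightarrow> real \<Rightarrow> bool" where
  "cond_circle L M r \<longleftrightarrow>
     (\<forall>n R. definable_rel L M n R \<and> chain_rel M n R \<longrightarrow> circle_rel M n r R)"

end

theory Submission
  imports Defs
begin

text \<open>
  Restricting a family indexed by the circle to \<open>N\<close> equidistant points gives a cycle of length
  \<open>N\<close>, so the condition on the circle implies the one on all cycles, which implies the one on
  large cycles. The content is the way back from large cycles to the circle.

  Measure arcs such that the full circle has length 1. By compactness only finitely many points of
  the circle need to be considered at a time; they must be placed on a long cycle so that a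
  nonzero arc of length at most \<open>1 / r\<close> becomes at least one and at most \<open>N / r\<close> steps
  (\<open>cyclic_placement\<close>). Rounding works for arcs strictly
  shorter than \<open>1 / r\<close>, but an arc of length exactly \<open>1 / r\<close> could become too long. If \<open>1 / r\<close> is
  rational, its denominator is made to divide \<open>N\<close>. If it is irrational, the points can first be
  moved slightly such that all arcs in question become strictly shorter than \<open>1 / r\<close>.

  Compactness is used inside the given saturated structure. Its saturation concerns types in one
  variable over fewer than \<open>\<kappa>\<close> parameters, whereas here continuum many variables are to be
  realized simultaneously. They are treated one by one, by Zorn's lemma (\<open>saturated_realizes\<close>);
  each step uses that the solvability of a finite system of constraints is expressed by a formula
  (\<open>solvability_definable\<close>).
\<close>

section \<open>Formulas: free variables, renaming, iterated quantifiers\<close>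

lemma finite_fv_tm: "finite (fv_tm t)"
  by (induction t) auto

lemma finite_fv: "finite (fv \<phi>)"
  by (induction \<phi>) (auto simp: finite_fv_tm)

lemma eval_tm_cong: "(\<And>x. x \<in> fv_tm t \<Longrightarrow> u x = v x) \<Longrightarrow> eval_tm M u t = eval_tm M v t"
proof (induction t)
  case (App f ts)
  then have "map (eval_tm M u) ts = map (eval_tm M v) ts"
    by (intro map_cong) auto
  then show ?case by (simp del: map_eq_conv)
qed auto

lemma sat_cong: "(\<And>x. x \<in> fv \<phi> \<Longrightarrow> u x = v x) \<Longrightarrow> sat M u \<phi> \<longleftrightarrow> sat M v \<phi>"
proof (induction \<phi> arbitrary: u v)
  case (Eql s t)
  then have "eval_tm M u s = eval_tm M v s" "eval_tm M u t = eval_tm M v t"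
    by (intro eval_tm_cong; simp)+
  then show ?case by simp
next
  case (Rel p ts)
  then have "map (eval_tm M u) ts = map (eval_tm M v) ts"
    by (intro map_cong refl eval_tm_cong) auto
  then show ?case by (simp del: map_eq_conv)
next
  case (Imp \<phi> \<psi>)
  then have "sat M u \<phi> = sat M v \<phi>" "sat M u \<psi> = sat M v \<psi>"
    by (metis UnCI fv.simps(4))+
  then show ?case by simp
next
  case (All x \<phi>)
  have "sat M (u(x := a)) \<phi> = sat M (v(x := a)) \<phi>" for a
    by (rule All.IH) (use All.prems in auto)
  then show ?case by simp
qed simp

fun ren_tm :: "(nat \<Rightarrow> nat) \<Rightarrow> 'f tm \<Rightarrow> 'f tm" where
  "ren_tm \<sigma> (Var x) = Var (\<sigma> x)"
| "ren_tm \<sigma> (App f ts) = App f (map (ren_tm \<sigma>) ts)"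

text \<open>
  The renaming \<open>\<sigma>\<close> may identify variables, so a bound variable has to move to a name outside the
  image of the free variables to avoid capture; any choice will do.
\<close>

fun ren :: "(nat \<Rightarrow> nat) \<Rightarrow> ('f, 'p) fm \<Rightarrow> ('f, 'p) fm" where
  "ren \<sigma> Falsum = Falsum"
| "ren \<sigma> (Eql s t) = Eql (ren_tm \<sigma> s) (ren_tm \<sigma> t)"
| "ren \<sigma> (Rel p ts) = Rel p (map (ren_tm \<sigma>) ts)"
| "ren \<sigma> (Imp \<phi> \<psi>) = Imp (ren \<sigma> \<phi>) (ren \<sigma> \<psi>)"
| "ren \<sigma> (All x \<phi>) = (let z = (SOME z. z \<notin> \<sigma> ` fv \<phi>) in All z (ren (\<sigma>(x := z)) \<phi>))"

lemma fresh: "(SOME z. z \<notin> \<sigma> ` fv \<phi>) \<notin> \<sigma> ` fv (\<phi> :: ('f, 'p) fm)" for \<sigma> :: "nat \<Rightarrow> nat"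
  by (rule someI_ex) (simp add: ex_new_if_finite finite_fv)

lemma wf_ren_tm: "wf_tm L t \<Longrightarrow> wf_tm L (ren_tm \<sigma> t)"
  by (induction t) auto

lemma wf_ren: "wf_fm L \<phi> \<Longrightarrow> wf_fm L (ren \<sigma> \<phi>)"
  by (induction \<phi> arbitrary: \<sigma>) (auto simp: wf_ren_tm Let_def)

lemma fv_ren_tm: "fv_tm (ren_tm \<sigma> t) = \<sigma> ` fv_tm t"
  by (induction t) auto

lemma fv_ren: "fv (ren \<sigma> \<phi>) \<subseteq> \<sigma> ` fv \<phi>"
proof (induction \<phi> arbitrary: \<sigma>)
  case (Imp \<phi> \<psi>)
  then show ?case by (simp add: image_Un) blast
next
  case (All x \<phi>)
  define z where "z = (SOME z. z \<notin> \<sigma> ` fv \<phi>)"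
  have "fv (ren (\<sigma>(x := z)) \<phi>) \<subseteq> (\<sigma>(x := z)) ` fv \<phi>"
    by (rule All)
  then show ?case by (auto simp: Let_def z_def[symmetric])
qed (auto simp: fv_ren_tm)

lemma eval_ren_tm: "eval_tm M v (ren_tm \<sigma> t) = eval_tm M (\<lambda>k. v (\<sigma> k)) t"
proof (induction t)
  case (App f ts)
  then have "map (\<lambda>t. eval_tm M v (ren_tm \<sigma> t)) ts = map (eval_tm M (\<lambda>k. v (\<sigma> k))) ts"
    by (intro map_cong) auto
  then show ?case by (simp add: o_def del: map_eq_conv)
qed simp

lemma sat_ren: "sat M v (ren \<sigma> \<phi>) \<longleftrightarrow> sat M (\<lambda>k. v (\<sigma> k)) \<phi>"
proof (induction \<phi> arbitrary: \<sigma> v)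
  case (Rel p ts)
  have "map (\<lambda>t. eval_tm M v (ren_tm \<sigma> t)) ts = map (eval_tm M (\<lambda>k. v (\<sigma> k))) ts"
    by (intro map_cong) (auto simp: eval_ren_tm)
  then show ?case by (simp add: o_def del: map_eq_conv)
next
  case (All x \<phi>)
  define z where "z = (SOME z. z \<notin> \<sigma> ` fv \<phi>)"
  have z: "z \<notin> \<sigma> ` fv \<phi>"
    unfolding z_def by (rule fresh)
  have "sat M (v(z := a)) (ren (\<sigma>(x := z)) \<phi>) \<longleftrightarrow> sat M ((\<lambda>k. v (\<sigma> k))(x := a)) \<phi>" for a
    unfolding All.IH by (rule sat_cong) (use z in auto)
  then show ?case by (simp add: Let_def z_def[symmetric])
qed (auto simp: eval_ren_tm)

definition Conj :: "('f, 'p) fm list \<Rightarrow> ('f, 'p) fm" where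
  "Conj \<phi>s = foldr (\<lambda>\<phi> \<psi>. Neg (Imp \<phi> (Neg \<psi>))) \<phi>s (Neg Falsum)"

lemma sat_Conj: "sat M v (Conj \<phi>s) \<longleftrightarrow> (\<forall>\<phi>\<in>set \<phi>s. sat M v \<phi>)"
  by (induction \<phi>s) (auto simp: Conj_def)

lemma wf_Conj: "wf_fm L (Conj \<phi>s) \<longleftrightarrow> (\<forall>\<phi>\<in>set \<phi>s. wf_fm L \<phi>)"
  by (induction \<phi>s) (auto simp: Conj_def)

lemma fv_Conj: "fv (Conj \<phi>s) = (\<Union>\<phi>\<in>set \<phi>s. fv \<phi>)"
  by (induction \<phi>s) (auto simp: Conj_def)

definition Exs :: "nat list \<Rightarrow> ('f, 'p) fm \<Rightarrow> ('f, 'p) fm" where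
  "Exs xs \<phi> = foldr (\<lambda>x \<psi>. Neg (All x (Neg \<psi>))) xs \<phi>"

text \<open>
  A single assignment describes all witnesses at once. A variable that occurs twice in
  the list does no harm, because the outer quantifier over it is vacuous.
\<close>

lemma sat_Exs:
  "sat M u (Exs xs \<phi>) \<longleftrightarrow>
     (\<exists>v. (\<forall>k. k \<notin> set xs \<longrightarrow> v k = u k) \<and> (\<forall>k\<in>set xs. v k \<in> univ M) \<and> sat M v \<phi>)"
proof (induction xs arbitrary: u)
  case Nil
  have "sat M u \<phi> \<longleftrightarrow> (\<exists>v. (\<forall>k. v k = u k) \<and> sat M v \<phi>)"
    by (metis ext)
  then show ?case by (simp add: Exs_def)
next
  case (Cons x xs)
  have "sat M u (Exs (x # xs) \<phi>) \<longleftrightarrow> (\<exists>a\<in>univ M. sat M (u(x := a)) (Exs xs \<phi>))"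
    by (simp add: Exs_def)
  also have "\<dots> \<longleftrightarrow> (\<exists>v. (\<forall>k. k \<notin> set (x # xs) \<longrightarrow> v k = u k) \<and>
      (\<forall>k\<in>set (x # xs). v k \<in> univ M) \<and> sat M v \<phi>)" (is "?l \<longleftrightarrow> ?r")
  proof
    assume ?l
    then show ?r unfolding Cons.IH by (metis fun_upd_apply set_ConsD list.set_intros)
  next
    assume ?r
    then obtain v where "\<forall>k. k \<notin> set (x # xs) \<longrightarrow> v k = u k"
      "\<forall>k\<in>set (x # xs). v k \<in> univ M" "sat M v \<phi>" by blast
    then show ?l unfolding Cons.IH by (intro bexI[of _ "v x"] exI[of _ v]) auto
  qed
  finally show ?case .
qed

lemma wf_Exs: "wf_fm L (Exs xs \<phi>) \<longleftrightarrow> wf_fm L \<phi>"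
  by (induction xs) (auto simp: Exs_def)

lemma fv_Exs: "fv (Exs xs \<phi>) = fv \<phi> - set xs"
  by (induction xs) (auto simp: Exs_def)

section \<open>Realizing many variables at once in a saturated structure\<close>

text \<open>
  A constraint is a formula together with the unknowns \<open>e k\<close> that its variables \<open>k\<close> stand for;
  unknowns live in an arbitrary type, which may be uncountable. Parameters of the formula are
  unknowns too: their values are prescribed by \<open>F\<close>.
\<close>

definition solves ::
  "('f, 'p, 'a) struct \<Rightarrow> (('f, 'p) fm \<times> (nat \<Rightarrow> 'v)) set \<Rightarrow> ('v \<times> 'a) set \<Rightarrow> ('v \<Rightarrow> 'a) \<Rightarrow> bool"
where
  "solves M \<Gamma> F g \<longleftrightarrow> range g \<subseteq> univ M \<and>
     (\<forall>(\<phi>, e)\<in>\<Gamma>. sat M (\<lambda>k. g (e k)) \<phi>) \<and> (\<forall>(w, c)\<in>F. g w = c)"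

text \<open>
  The set of values that one unknown takes in the solutions of a finite system is defined by a
  formula with the prescribed values as parameters: only finitely many unknowns occur, so
  they can be numbered and quantified existentially. Variable 0 is the value in question,
  the next ones are the parameters, and the unknowns take the block of variables after them.
  The unknown \<open>x\<close> and those fixed by \<open>F\<close> are also quantified and tied to the lower variables by
  equations, which makes it irrelevant whether they coincide.
\<close>

lemma solvability_definable:
  fixes M :: "('f, 'p, 'a) struct" and \<Gamma> :: "(('f, 'p) fm \<times> (nat \<Rightarrow> 'v)) set"
  assumes "finite \<Gamma>" "finite F" and wf: "\<And>\<phi> e. (\<phi>, e) \<in> \<Gamma> \<Longrightarrow> wf_fm L \<phi>"
    and ne: "univ M \<noteq> {}"
  obtains \<psi> :: "('f, 'p) fm" and cs where "wf_fm L \<psi>" "set cs \<subseteq> Range F" "fv \<psi> \<subseteq> {..<1 + length cs}"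
    "\<And>a. sat M (env (a # cs)) \<psi> \<longleftrightarrow> (\<exists>g. solves M \<Gamma> F g \<and> g x = a)"
proof -
  obtain fs where fs: "set fs = F" using assms(2) finite_list by blast
  obtain gs where gs: "set gs = \<Gamma>" using assms(1) finite_list by blast
  define W where "W = insert x (Domain F \<union> (\<Union>(\<phi>, e)\<in>\<Gamma>. e ` fv \<phi>))"
  have "finite W"
    using assms(1,2) by (auto simp: W_def finite_fv finite_Domain)
  then obtain ix where ix: "bij_betw ix W {..<card W}"
    using ex_bij_betw_finite_nat[of W] by (auto simp: atLeast0LessThan)
  have inj: "inj_on ix W" and ixW: "\<And>w. w \<in> W \<Longrightarrow> ix w < card W"
    using ix by (auto simp: bij_betw_def)
  define cs where "cs = map snd fs"
  define B where "B = 1 + length cs"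
  define eqs :: "('f, 'p) fm list" where "eqs = Eql (Var (B + ix x)) (Var 0) #
    map (\<lambda>j. Eql (Var (B + ix (fst (fs ! j)))) (Var (Suc j))) [0..<length fs]"
  define \<theta> where "\<theta> = Conj (eqs @ map (\<lambda>(\<phi>, e). ren (\<lambda>k. B + ix (e k)) \<phi>) gs)"
  define \<psi> where "\<psi> = Exs [B..<B + card W] \<theta>"
  have inW: "fst (fs ! j) \<in> W" if "j < length fs" for j
    using that fs nth_mem[OF that] unfolding W_def by (metis DomainI UnI1 insertI2 prod.collapse)
  have eW: "e k \<in> W" if "(\<phi>, e) \<in> \<Gamma>" "k \<in> fv \<phi>" for \<phi> e k
    using that by (auto simp: W_def)
  have xW: "x \<in> W" by (simp add: W_def)
  have sat_eqs: "(\<forall>\<phi>\<in>set eqs. sat M v \<phi>) \<longleftrightarrow>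
      v (B + ix x) = v 0 \<and> (\<forall>j<length fs. v (B + ix (fst (fs ! j))) = v (Suc j))" for v
    by (auto simp: eqs_def)
  have sat_\<theta>: "sat M v \<theta> \<longleftrightarrow> v (B + ix x) = v 0 \<and>
      (\<forall>j<length fs. v (B + ix (fst (fs ! j))) = v (Suc j)) \<and>
      (\<forall>(\<phi>, e)\<in>\<Gamma>. sat M (\<lambda>k. v (B + ix (e k))) \<phi>)" for v
    unfolding \<theta>_def sat_Conj set_append ball_Un sat_eqs
    by (auto simp: gs[symmetric] sat_ren)
  have "wf_fm L \<psi>"
    using wf by (auto simp: \<psi>_def \<theta>_def wf_Exs wf_Conj eqs_def wf_ren gs)
  moreover have "set cs \<subseteq> Range F"
    by (auto simp: cs_def fs Range_snd)
  moreover have "fv \<psi> \<subseteq> {..<1 + length cs}"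
  proof -
    have "fv (ren (\<lambda>k. B + ix (e k)) \<phi>) \<subseteq> {B..<B + card W}" if "(\<phi>, e) \<in> \<Gamma>" for \<phi> e
      using fv_ren[of "\<lambda>k. B + ix (e k)" \<phi>] eW[OF that] ixW by fastforce
    moreover have "fv \<phi> \<subseteq> {..<B + card W}" if "\<phi> \<in> set eqs" for \<phi>
      using that ixW[OF xW] ixW[OF inW] by (auto simp: eqs_def B_def cs_def)
    ultimately have "fv \<theta> \<subseteq> {..<B + card W}"
      by (fastforce simp: \<theta>_def fv_Conj gs)
    then show ?thesis by (auto simp: \<psi>_def fv_Exs B_def)
  qed
  moreover have "sat M (env (a # cs)) \<psi> \<longleftrightarrow> (\<exists>g. solves M \<Gamma> F g \<and> g x = a)" for a
  proof
    assume "sat M (env (a # cs)) \<psi>"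
    then obtain v where v: "\<And>k. k \<notin> {B..<B + card W} \<Longrightarrow> v k = env (a # cs) k"
      "\<And>k. k \<in> {B..<B + card W} \<Longrightarrow> v k \<in> univ M" "sat M v \<theta>"
      unfolding \<psi>_def sat_Exs set_upt by blast
    obtain d where d: "d \<in> univ M" using ne by blast
    define g where "g w = (if w \<in> W then v (B + ix w) else d)" for w
    have "range g \<subseteq> univ M"
      using v(2) ixW d by (auto simp: g_def)
    moreover have "sat M (\<lambda>k. g (e k)) \<phi>" if "(\<phi>, e) \<in> \<Gamma>" for \<phi> e
    proof -
      have "sat M (\<lambda>k. v (B + ix (e k))) \<phi>"
        using v(3) that unfolding sat_\<theta> by auto
      then show ?thesis
        by (rule iffD1[OF sat_cong, rotated]) (use eW[OF that] in \<open>simp add: g_def\<close>)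
    qed
    moreover have "g w = c" if wc: "(w, c) \<in> F" for w c
    proof -
      obtain j where j: "j < length fs" "fs ! j = (w, c)"
        using wc fs by (metis in_set_conv_nth)
      have "g w = v (Suc j)"
        using v(3) inW[OF j(1)] j unfolding sat_\<theta> g_def by auto
      also have "\<dots> = c"
        using j by (subst v(1)) (auto simp: B_def cs_def env_def)
      finally show ?thesis .
    qed
    moreover have "g x = a"
      using v(3) v(1)[of 0] xW unfolding sat_\<theta> g_def by (auto simp: B_def env_def)
    ultimately show "\<exists>g. solves M \<Gamma> F g \<and> g x = a"
      unfolding solves_def by blast
  next
    assume "\<exists>g. solves M \<Gamma> F g \<and> g x = a"
    then obtain g where sol: "solves M \<Gamma> F g" and g4: "g x = a" by blast
    have g: "range g \<subseteq> univ M" "\<And>\<phi> e. (\<phi>, e) \<in> \<Gamma> \<Longrightarrow> sat M (\<lambda>k. g (e k)) \<phi>"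
      "\<And>w c. (w, c) \<in> F \<Longrightarrow> g w = c"
      using sol unfolding solves_def by auto
    define v where "v k = (if k \<in> {B..<B + card W} then g (inv_into W ix (k - B))
      else env (a # cs) k)" for k
    have vW: "v (B + ix w) = g w" if "w \<in> W" for w
      using that inj ixW by (simp add: v_def)
    have "sat M (\<lambda>k. v (B + ix (e k))) \<phi>" if "(\<phi>, e) \<in> \<Gamma>" for \<phi> e
      using g(2)[OF that]
      by (rule iffD1[OF sat_cong, rotated]) (use eW[OF that] vW in simp)
    moreover have "v (B + ix (fst (fs ! j))) = v (Suc j)" if j: "j < length fs" for j
    proof -
      have "g (fst (fs ! j)) = snd (fs ! j)"
        using j fs by (intro g(3)) auto
      then show ?thesis
        using j by (subst vW[OF inW[OF j]]) (simp add: v_def B_def cs_def env_def)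
    qed
    moreover have "v (B + ix x) = v 0"
      using g4 by (subst vW[OF xW]) (simp add: v_def B_def env_def)
    ultimately have "sat M v \<theta>"
      unfolding sat_\<theta> by blast
    moreover have "v k \<in> univ M" if "k \<in> {B..<B + card W}" for k
      using that g(1) by (auto simp: v_def)
    ultimately show "sat M (env (a # cs)) \<psi>"
      unfolding \<psi>_def sat_Exs by (intro exI[of _ v]) (auto simp: v_def)
  qed
  ultimately show thesis using that by blast
qed


text \<open>
  Saturation speaks of types in a single variable. To realize a system in many unknowns,
  prescribe more and more values while keeping every finite subsystem solvable. This condition
  has finite character, so Zorn's lemma yields a maximal prescription. It leaves no unknown
  \<open>x\<close> free: the formulas describing the possible values of \<open>x\<close> in finite
  subsystems form a type over the values already used, of which there are at most as many as
  unknowns, and a realization of that type could be added.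
\<close>

lemma saturated_realizes:
  fixes M :: "('f, 'p, 'a) struct" and \<Gamma> :: "(('f, 'p) fm \<times> (nat \<Rightarrow> 'v)) set"
  assumes sat: "saturated L M \<kappa>" and ne: "univ M \<noteq> {}" and card: "|UNIV :: 'v set| <o \<kappa>"
    and wf: "\<And>\<phi> e. (\<phi>, e) \<in> \<Gamma> \<Longrightarrow> wf_fm L \<phi>"
    and fin: "\<And>\<Gamma>'. \<Gamma>' \<subseteq> \<Gamma> \<Longrightarrow> finite \<Gamma>' \<Longrightarrow> \<exists>g. solves M \<Gamma>' F\<^sub>0 g"
  shows "\<exists>g. solves M \<Gamma> F\<^sub>0 g"
proof -
  define ok where "ok F \<longleftrightarrow> F\<^sub>0 \<subseteq> F \<and> (\<forall>\<Gamma>' F'. \<Gamma>' \<subseteq> \<Gamma> \<and> finite \<Gamma>' \<and> F' \<subseteq> F \<and> finite F' \<longrightarrow>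
    (\<exists>g. solves M \<Gamma>' F' g))" for F
  have mono: "solves M \<Gamma>2 F2 g" if "solves M \<Gamma>1 F1 g" "\<Gamma>2 \<subseteq> \<Gamma>1" "F2 \<subseteq> F1" for \<Gamma>1 \<Gamma>2 F1 F2 and g :: "'v \<Rightarrow> 'a"
    using that unfolding solves_def by (auto 0 2 dest: subsetD)
  have "ok F\<^sub>0"
    unfolding ok_def
  proof (intro conjI allI impI order_refl)
    fix \<Gamma>' F' assume *: "\<Gamma>' \<subseteq> \<Gamma> \<and> finite \<Gamma>' \<and> F' \<subseteq> F\<^sub>0 \<and> finite F'"
    then obtain g where "solves M \<Gamma>' F\<^sub>0 g" using fin by blast
    then have "solves M \<Gamma>' F' g" using mono * by blast
    then show "\<exists>g. solves M \<Gamma>' F' g" by blast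
  qed
  moreover have "ok (\<Union>C)" if C: "C \<noteq> {}" "subset.chain {F. ok F} C" for C
  proof -
    have okC: "ok F" if "F \<in> C" for F
      using C(2) that by (auto simp: subset.chain_def)
    have "F\<^sub>0 \<subseteq> \<Union>C"
      using C(1) okC unfolding ok_def by blast
    moreover have "\<exists>g. solves M \<Gamma>' F' g" if *: "\<Gamma>' \<subseteq> \<Gamma> \<and> finite \<Gamma>' \<and> F' \<subseteq> \<Union>C \<and> finite F'" for \<Gamma>' F'
    proof -
    obtain F where F: "F \<in> C" "F' \<subseteq> F"
      using finite_subset_Union_chain[of F' C] C * by metis
    then show ?thesis
      using * okC[OF F(1)] F(2) unfolding ok_def by blast
    qed
    ultimately show ?thesis unfolding ok_def by blast
  qed
  ultimately obtain F where F: "ok F" and max: "\<And>F'. ok F' \<Longrightarrow> F \<subseteq> F' \<Longrightarrow> F' = F"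
    using subset_Zorn_nonempty[of "{F. ok F}"] by auto
  have okF: "\<exists>g. solves M \<Gamma>' F' g" if "\<Gamma>' \<subseteq> \<Gamma>" "finite \<Gamma>'" "F' \<subseteq> F" "finite F'" for \<Gamma>' F'
    using F that unfolding ok_def by blast
  have uniq: "c = d" if "(w, c) \<in> F" "(w, d) \<in> F" for w c d
    using okF[of "{}" "{(w, c), (w, d)}"] that by (auto simp: solves_def)
  have "Range F \<subseteq> univ M"
  proof
    fix c assume "c \<in> Range F"
    then obtain w where "(w, c) \<in> F" by blast
    then show "c \<in> univ M" using okF[of "{}" "{(w, c)}"] by (auto simp: solves_def)
  qed
  moreover have "|Range F| <o \<kappa>"
  proof -
    have "Range F \<subseteq> range (\<lambda>w. THE c. (w, c) \<in> F)"
    proof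
      fix c assume "c \<in> Range F"
      then obtain w where w: "(w, c) \<in> F" by blast
      have "(THE c. (w, c) \<in> F) = c"
        by (rule the_equality) (use w uniq in auto)
      then show "c \<in> range (\<lambda>w. THE c. (w, c) \<in> F)" by (intro range_eqI[of _ _ w]) simp
    qed
    then show ?thesis
      by (meson card card_of_image card_of_mono1 ordLeq_ordLess_trans)
  qed
  ultimately have realize: "\<exists>a\<in>univ M. \<forall>(\<phi>, cs)\<in>p. sat M (env (a # cs)) \<phi>"
    if "type_over L M (Range F) p" for p
    using sat that unfolding saturated_def by blast
  have total: "x \<in> Domain F" for x
  proof -
    \<comment> \<open>\<open>says \<psi> cs \<Gamma>' F'\<close>: the formula \<open>\<psi>(_, cs)\<close> defines the values of \<open>x\<close> in solutions of \<open>\<Gamma>', F'\<close>\<close>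
    define says where "says \<psi> cs \<Gamma>' F' \<longleftrightarrow> \<Gamma>' \<subseteq> \<Gamma> \<and> finite \<Gamma>' \<and> F' \<subseteq> F \<and> finite F' \<and>
      (\<forall>a. sat M (env (a # cs)) \<psi> \<longleftrightarrow> (\<exists>g. solves M \<Gamma>' F' g \<and> g x = a))" for \<psi> cs \<Gamma>' F'
    define p where "p = {(\<psi>, cs). wf_fm L \<psi> \<and> set cs \<subseteq> Range F \<and> fv \<psi> \<subseteq> {..<1 + length cs} \<and>
      (\<exists>\<Gamma>' F'. says \<psi> cs \<Gamma>' F')}"
    have "type_over L M (Range F) p"
      unfolding type_over_def
    proof (intro conjI allI impI)
      show "\<forall>(\<phi>, cs)\<in>p. wf_fm L \<phi> \<and> set cs \<subseteq> Range F \<and> fv \<phi> \<subseteq> {..<1 + length cs}"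
        by (auto simp: p_def)
      fix q assume q: "q \<subseteq> p" "finite q"
      have "\<exists>\<Gamma>' F'. says (fst z) (snd z) \<Gamma>' F'" if "z \<in> q" for z
        using subsetD[OF q(1) that] by (cases z) (simp add: p_def)
      then obtain G H where GH: "\<And>z. z \<in> q \<Longrightarrow> says (fst z) (snd z) (G z) (H z)"
        by metis
      then have GH': "G z \<subseteq> \<Gamma>" "finite (G z)" "H z \<subseteq> F" "finite (H z)" if "z \<in> q" for z
        using that unfolding says_def by blast+
      have "\<exists>g. solves M (\<Union>(G ` q)) (\<Union>(H ` q)) g"
        by (intro okF UN_least finite_UN_I q(2) GH')
      then obtain g where g: "solves M (\<Union>(G ` q)) (\<Union>(H ` q)) g" by blast
      have "sat M (env (g x # snd z)) (fst z)" if "z \<in> q" for z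
      proof -
        have "solves M (G z) (H z) g"
          using that by (intro mono[OF g]) auto
        then show ?thesis using GH[OF that] unfolding says_def by blast
      qed
      moreover have "g x \<in> univ M" using g by (auto simp: solves_def)
      ultimately show "\<exists>a\<in>univ M. \<forall>(\<phi>, cs)\<in>q. sat M (env (a # cs)) \<phi>"
        by (intro bexI[of _ "g x"] ballI) (simp_all add: case_prod_beta)
    qed
    then obtain a where a: "a \<in> univ M" "\<And>\<phi> cs. (\<phi>, cs) \<in> p \<Longrightarrow> sat M (env (a # cs)) \<phi>"
      using realize by blast
    \<comment> \<open>\<open>a\<close> lies in the value set of \<open>x\<close> for every finite subsystem, so prescribing it is harmless\<close>
    have "ok (insert (x, a) F)"
      unfolding ok_def
    proof (intro conjI allI impI)
      show "F\<^sub>0 \<subseteq> insert (x, a) F" using F by (auto simp: ok_def)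
      fix \<Gamma>' F' assume *: "\<Gamma>' \<subseteq> \<Gamma> \<and> finite \<Gamma>' \<and> F' \<subseteq> insert (x, a) F \<and> finite F'"
      define F'' where "F'' = F' - {(x, a)}"
      have F'': "F'' \<subseteq> F" "finite F''" using * by (auto simp: F''_def)
      have fin': "finite \<Gamma>'" and wf': "\<And>\<phi> e. (\<phi>, e) \<in> \<Gamma>' \<Longrightarrow> wf_fm L \<phi>"
        using * wf by blast+
      obtain \<psi> :: "('f, 'p) fm" and cs where \<psi>: "wf_fm L \<psi>" "set cs \<subseteq> Range F''"
        "fv \<psi> \<subseteq> {..<1 + length cs}"
        "\<And>a. sat M (env (a # cs)) \<psi> \<longleftrightarrow> (\<exists>g. solves M \<Gamma>' F'' g \<and> g x = a)"
        by (rule solvability_definable[where x = x, OF fin' F''(2) _ ne]) (rule wf', assumption, rule that)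
      have "says \<psi> cs \<Gamma>' F''"
        using \<psi>(4) * F'' by (simp add: says_def)
      moreover have "set cs \<subseteq> Range F" using \<psi>(2) F''(1) by blast
      ultimately have "(\<psi>, cs) \<in> p"
        using \<psi>(1,3) by (auto simp: p_def)
      then obtain g where "solves M \<Gamma>' F'' g" "g x = a"
        using a(2) \<psi>(4) by blast
      then have "solves M \<Gamma>' F' g"
        unfolding solves_def F''_def Ball_def split_paired_All by auto
      then show "\<exists>g. solves M \<Gamma>' F' g" by blast
    qed
    then have "insert (x, a) F = F" using max by blast
    then show ?thesis by blast
  qed
  then have "\<forall>x. \<exists>y. (x, y) \<in> F" by blast
  then obtain g where g: "\<And>x. (x, g x) \<in> F" by metis
  have F\<^sub>0: "F\<^sub>0 \<subseteq> F" using F by (simp add: ok_def)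
  have "solves M \<Gamma> F\<^sub>0 g"
    unfolding solves_def
  proof (intro conjI)
    show "range g \<subseteq> univ M"
      using g \<open>Range F \<subseteq> univ M\<close> by blast
    show "\<forall>(w, c)\<in>F\<^sub>0. g w = c"
      using F\<^sub>0 g uniq by fast
    show "\<forall>(\<phi>, e)\<in>\<Gamma>. sat M (\<lambda>k. g (e k)) \<phi>"
    proof safe
      fix \<phi> e assume *: "(\<phi>, e) \<in> \<Gamma>"
      \<comment> \<open>A solution \<open>h\<close> of this one constraint that is forced to agree with \<open>g\<close> on the unknowns in it.\<close>
      obtain h where h: "solves M {(\<phi>, e)} ((\<lambda>x. (x, g x)) ` e ` fv \<phi>) h"
        using okF[of "{(\<phi>, e)}" "(\<lambda>x. (x, g x)) ` e ` fv \<phi>"] * g by (auto simp: finite_fv)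
      then have "sat M (\<lambda>k. h (e k)) \<phi>" by (auto simp: solves_def)
      then show "sat M (\<lambda>k. g (e k)) \<phi>"
        by (rule iffD1[OF sat_cong, rotated]) (use h in \<open>auto simp: solves_def\<close>)
    qed
  qed
  then show ?thesis by blast
qed

section \<open>Placing finitely many points of the circle on a cycle\<close>

text \<open>
  Points of the circle of circumference 1 are represented by reals; \<open>frac (y - x)\<close> is the length
  of the arc from \<open>x\<close> to \<open>y\<close>, and \<open>p y - p x - \<lfloor>y - x\<rfloor> * N\<close> the number of steps from the
  position of \<open>x\<close> to that of \<open>y\<close> on a cycle of length \<open>N\<close>. Rounding \<open>N * x\<close> down can lengthen an
  arc by almost one step, and an arc of length exactly \<open>\<alpha>\<close> has no room for that. If \<open>N\<close> is a
  multiple of the denominator of \<open>\<alpha>\<close>, then \<open>N * \<alpha>\<close> is an integer and rounding respects the bound.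
\<close>

lemma cyclic_placement_rational:
  fixes \<alpha> :: real
  assumes "finite S" "0 < \<alpha>" "\<alpha> \<in> \<rat>"
  shows "\<exists>N\<ge>N\<^sub>0. \<exists>p :: real \<Rightarrow> int. \<forall>x\<in>S. \<forall>y\<in>S. 0 < frac (y - x) \<and> frac (y - x) \<le> \<alpha> \<longrightarrow>
    1 \<le> p y - p x - \<lfloor>y - x\<rfloor> * int N \<and> p y - p x - \<lfloor>y - x\<rfloor> * int N \<le> real N * \<alpha>"
proof -
  obtain c d :: int where \<alpha>: "\<alpha> = c / d" "d > 0"
    using assms(3) by (metis Rats_cases')
  define D where "D = nat d"
  have D: "D > 0" "real D * \<alpha> = c" using \<alpha> by (simp_all add: D_def)
  have ev: "\<forall>\<^sub>F K in sequentially. \<forall>x\<in>S. \<forall>y\<in>S. 0 < frac (y - x) \<longrightarrow> real (D * K) * frac (y - x) \<ge> 1"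
  proof (intro eventually_ball_finite assms(1) ballI)
    fix x y :: real
    show "\<forall>\<^sub>F K in sequentially. 0 < frac (y - x) \<longrightarrow> real (D * K) * frac (y - x) \<ge> 1"
    proof (cases "0 < frac (y - x)")
      case True
      then have "filterlim (\<lambda>K. (real D * frac (y - x)) * real K) at_top sequentially"
        using D by (intro filterlim_tendsto_pos_mult_at_top[OF tendsto_const] filterlim_real_sequentially) simp
      then have "\<forall>\<^sub>F K in sequentially. 1 \<le> (real D * frac (y - x)) * real K"
        by (simp add: filterlim_at_top)
      then show ?thesis by (simp add: mult_ac)
    qed simp
  qed
  obtain K where K: "K \<ge> N\<^sub>0" "\<And>x y. x \<in> S \<Longrightarrow> y \<in> S \<Longrightarrow> 0 < frac (y - x) \<Longrightarrow> real (D * K) * frac (y - x) \<ge> 1"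
    using eventually_happens[OF eventually_conj[OF ev eventually_ge_at_top[of N\<^sub>0]]] by auto
  define N where "N = D * K"
  have N: "real N * \<alpha> = real_of_int (c * int K)"
    using D by (simp add: N_def mult_ac)
  have "1 \<le> \<lfloor>real N * y\<rfloor> - \<lfloor>real N * x\<rfloor> - \<lfloor>y - x\<rfloor> * int N \<and>
      \<lfloor>real N * y\<rfloor> - \<lfloor>real N * x\<rfloor> - \<lfloor>y - x\<rfloor> * int N \<le> real N * \<alpha>"
    if xy: "x \<in> S" "y \<in> S" "0 < frac (y - x)" "frac (y - x) \<le> \<alpha>" for x y :: real
  proof -
    have y: "real N * y = real N * x + real_of_int (\<lfloor>y - x\<rfloor> * int N) + real N * frac (y - x)"
      by (simp add: frac_def algebra_simps)
    have "real N * frac (y - x) \<ge> 1" using K(2)[OF xy(1-3)] by (simp add: N_def)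
    then have "\<lfloor>real N * y\<rfloor> \<ge> \<lfloor>real N * x\<rfloor> + \<lfloor>y - x\<rfloor> * int N + 1"
      unfolding y by linarith
    moreover have "real N * frac (y - x) \<le> real_of_int (c * int K)"
      using xy(4) mult_left_mono[of "frac (y - x)" \<alpha> "real N"] N by simp
    then have "\<lfloor>real N * y\<rfloor> \<le> \<lfloor>real N * x\<rfloor> + \<lfloor>y - x\<rfloor> * int N + c * int K"
      unfolding y by linarith
    ultimately show ?thesis unfolding N by linarith
  qed
  moreover have "N \<ge> N\<^sub>0" using K(1) D(1) unfolding N_def
    by (metis One_nat_def Suc_leI le_trans mult.commute mult_le_mono2 mult_1_right)
  ultimately show ?thesis by (intro exI[of _ N] conjI exI[of _ "\<lambda>x. \<lfloor>real N * x\<rfloor>"]) auto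
qed

text \<open>
  The orbits of the rotation by an irrational \<open>\<alpha>\<close> are infinite, so each point has a well-defined
  number of steps from a chosen representative of its orbit.
\<close>

lemma irrational_step_count:
  fixes \<alpha> :: real
  assumes "\<alpha> \<notin> \<rat>"
  obtains k :: "real \<Rightarrow> int" where "\<And>x m. k (x + \<alpha> + of_int m) = k x + 1"
proof -
  define \<rho> where "\<rho> x = (SOME z. \<exists>a b. z = x + of_int a + of_int b * \<alpha>)" for x
  have "\<exists>b a. x = \<rho> x + of_int a + of_int b * \<alpha>" for x
  proof -
    have "\<exists>a b. \<rho> x = x + of_int a + of_int b * \<alpha>"
      unfolding \<rho>_def by (rule someI[of _ x]) (auto intro: exI[of _ 0])
    then obtain a b where "\<rho> x = x + of_int a + of_int b * \<alpha>" by blast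
    then show ?thesis by (intro exI[of _ "-b"] exI[of _ "-a"]) simp
  qed
  then obtain k l where kl: "\<And>x. x = \<rho> x + of_int (l x) + of_int (k x) * \<alpha>" by metis
  have "k (x + \<alpha> + of_int m) = k x + 1" for x and m :: int
  proof -
    define y where "y = x + \<alpha> + of_int m"
    have "(\<exists>a b. z = x + of_int a + of_int b * \<alpha>) \<longleftrightarrow> (\<exists>a b. z = y + of_int a + of_int b * \<alpha>)" for z
    proof safe
      fix a b
      show "\<exists>a' b'. x + of_int a + of_int b * \<alpha> = y + of_int a' + of_int b' * \<alpha>"
        by (rule exI[of _ "a - m"], rule exI[of _ "b - 1"]) (simp add: y_def algebra_simps)
      show "\<exists>a' b'. y + of_int a + of_int b * \<alpha> = x + of_int a' + of_int b' * \<alpha>"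
        by (rule exI[of _ "a + m"], rule exI[of _ "b + 1"]) (simp add: y_def algebra_simps)
    qed
    then have \<rho>: "\<rho> y = \<rho> x" by (simp add: \<rho>_def)
    define b where "b = k y - k x - 1"
    have "of_int b * \<alpha> = of_int (m + l x - l y)"
      using kl[of x] kl[of y] \<rho> by (simp add: b_def y_def algebra_simps)
    then have "b = 0"
      using assms by (metis Rats_divide Rats_of_int nonzero_mult_div_cancel_left of_int_eq_0_iff)
    then show ?thesis by (simp add: b_def y_def)
  qed
  then show thesis using that by blast
qed

text \<open>
  Moving each point back by \<open>\<epsilon>\<close> times its step count shortens every arc of length exactly \<open>\<alpha>\<close> to
  \<open>\<alpha> - \<epsilon>\<close>, while for small \<open>\<epsilon>\<close> the finitely many arcs strictly between 0 and \<open>\<alpha>\<close> stay there.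
  With all inequalities strict, rounding is harmless for large \<open>N\<close>. For rational \<open>\<alpha>\<close> such a
  perturbation need not exist: \<open>\<alpha> = 1 / 3\<close> and three equidistant points leave no slack.
\<close>

lemma cyclic_placement_irrational:
  fixes \<alpha> :: real
  assumes fin: "finite S" and "0 < \<alpha>" "\<alpha> \<notin> \<rat>"
  shows "\<exists>N\<ge>N\<^sub>0. \<exists>p :: real \<Rightarrow> int. \<forall>x\<in>S. \<forall>y\<in>S. 0 < frac (y - x) \<and> frac (y - x) \<le> \<alpha> \<longrightarrow>
    1 \<le> p y - p x - \<lfloor>y - x\<rfloor> * int N \<and> p y - p x - \<lfloor>y - x\<rfloor> * int N \<le> real N * \<alpha>"
proof -
  obtain k :: "real \<Rightarrow> int" where k: "\<And>x m. k (x + \<alpha> + of_int m) = k x + 1"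
    using irrational_step_count[OF assms(3)] by blast
  define d where "d \<epsilon> x y = frac (y - x) - \<epsilon> * (real_of_int (k y) - real_of_int (k x))" for \<epsilon> x y
  have "\<forall>\<^sub>F \<epsilon> in at_right 0. \<forall>x\<in>S. \<forall>y\<in>S. 0 < frac (y - x) \<and> frac (y - x) \<le> \<alpha> \<longrightarrow> 0 < d \<epsilon> x y \<and> d \<epsilon> x y < \<alpha>"
  proof (intro eventually_ball_finite fin ballI)
    fix x y :: real
    have lim: "((\<lambda>\<epsilon>. d \<epsilon> x y) \<longlongrightarrow> frac (y - x)) (at_right 0)"
      unfolding d_def by (rule tendsto_eq_intros refl | simp)+
    consider "frac (y - x) = 0 \<or> frac (y - x) > \<alpha>" | "frac (y - x) = \<alpha>" | "0 < frac (y - x)" "frac (y - x) < \<alpha>"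
      using frac_ge_0[of "y - x"] by linarith
    then show "\<forall>\<^sub>F \<epsilon> in at_right 0. 0 < frac (y - x) \<and> frac (y - x) \<le> \<alpha> \<longrightarrow> 0 < d \<epsilon> x y \<and> d \<epsilon> x y < \<alpha>"
    proof cases
      case 1
      then show ?thesis by auto
    next
      case 2
      then have "y = x + \<alpha> + of_int \<lfloor>y - x\<rfloor>" by (simp add: frac_def)
      then have "k y = k x + 1" using k by metis
      then have "d \<epsilon> x y = \<alpha> - \<epsilon>" for \<epsilon> using 2 by (simp add: d_def)
      moreover have "\<forall>\<^sub>F \<epsilon> in at_right (0::real). 0 < \<epsilon> \<and> \<epsilon> < \<alpha>"
        using assms(2) by (auto simp: eventually_at_right_field)
      ultimately show ?thesis by (auto elim!: eventually_mono)
    next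
      case 3
      show ?thesis
        using eventually_conj[OF order_tendstoD(1)[OF lim 3(1)] order_tendstoD(2)[OF lim 3(2)]]
        by (auto elim: eventually_mono)
    qed
  qed
  from eventually_happens'[OF trivial_limit_at_right_real this]
  obtain \<epsilon> where \<epsilon>: "\<And>x y. x \<in> S \<Longrightarrow> y \<in> S \<Longrightarrow> 0 < frac (y - x) \<Longrightarrow> frac (y - x) \<le> \<alpha> \<Longrightarrow> 0 < d \<epsilon> x y \<and> d \<epsilon> x y < \<alpha>"
    by blast
  have ev: "\<forall>\<^sub>F N in sequentially. \<forall>x\<in>S. \<forall>y\<in>S. 0 < frac (y - x) \<and> frac (y - x) \<le> \<alpha> \<longrightarrow>
    1 \<le> d \<epsilon> x y * real N \<and> 1 \<le> (\<alpha> - d \<epsilon> x y) * real N"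
  proof (intro eventually_ball_finite fin ballI)
    fix x y assume xy: "x \<in> S" "y \<in> S"
    have ev: "\<forall>\<^sub>F N in sequentially. 1 \<le> c * real N" if "c > 0" for c :: real
      using filterlim_tendsto_pos_mult_at_top[OF tendsto_const that filterlim_real_sequentially]
      by (simp add: filterlim_at_top)
    show "\<forall>\<^sub>F N in sequentially. 0 < frac (y - x) \<and> frac (y - x) \<le> \<alpha> \<longrightarrow>
      1 \<le> d \<epsilon> x y * real N \<and> 1 \<le> (\<alpha> - d \<epsilon> x y) * real N"
    proof (cases "0 < frac (y - x) \<and> frac (y - x) \<le> \<alpha>")
      case True
      then have "0 < d \<epsilon> x y" "0 < \<alpha> - d \<epsilon> x y" using \<epsilon> xy by auto
      then show ?thesis using eventually_conj[OF ev ev] by (auto elim: eventually_mono)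
    qed auto
  qed
  obtain N where N: "N \<ge> N\<^sub>0" "\<And>x y. x \<in> S \<Longrightarrow> y \<in> S \<Longrightarrow> 0 < frac (y - x) \<Longrightarrow> frac (y - x) \<le> \<alpha> \<Longrightarrow>
    1 \<le> d \<epsilon> x y * real N \<and> 1 \<le> (\<alpha> - d \<epsilon> x y) * real N"
    using eventually_happens[OF eventually_conj[OF ev eventually_ge_at_top[of N\<^sub>0]]] by auto
  define p where "p x = \<lfloor>real N * (x - \<epsilon> * k x)\<rfloor>" for x
  have "1 \<le> p y - p x - \<lfloor>y - x\<rfloor> * int N \<and> p y - p x - \<lfloor>y - x\<rfloor> * int N \<le> real N * \<alpha>"
    if xy: "x \<in> S" "y \<in> S" "0 < frac (y - x)" "frac (y - x) \<le> \<alpha>" for x y :: real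
  proof -
    have y: "real N * (y - \<epsilon> * k y) = real N * (x - \<epsilon> * k x) + real_of_int (\<lfloor>y - x\<rfloor> * int N) + d \<epsilon> x y * real N"
      by (simp add: frac_def d_def algebra_simps)
    have 1: "1 \<le> d \<epsilon> x y * real N" and "1 \<le> (\<alpha> - d \<epsilon> x y) * real N"
      using N(2)[OF xy] by auto
    then have 2: "d \<epsilon> x y * real N + 1 \<le> real N * \<alpha>" by (simp add: algebra_simps)
    show ?thesis unfolding p_def y using 1 2 by linarith
  qed
  then show ?thesis using N(1) by blast
qed

lemma cyclic_placement:
  fixes \<alpha> :: real
  assumes "finite S" "0 < \<alpha>"
  obtains N and q :: "real \<Rightarrow> nat" where "N \<ge> N\<^sub>0" "\<And>x. q x < N"
    "\<And>x y. x \<in> S \<Longrightarrow> y \<in> S \<Longrightarrow> 0 < frac (y - x) \<Longrightarrow> frac (y - x) \<le> \<alpha> \<Longrightarrow>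
       \<exists>j. 1 \<le> j \<and> real j \<le> real N * \<alpha> \<and> q y = (q x + j) mod N"
proof -
  obtain N and p :: "real \<Rightarrow> int" where N: "N \<ge> Suc N\<^sub>0" and
    p: "\<And>x y. x \<in> S \<Longrightarrow> y \<in> S \<Longrightarrow> 0 < frac (y - x) \<Longrightarrow> frac (y - x) \<le> \<alpha> \<Longrightarrow>
    1 \<le> p y - p x - \<lfloor>y - x\<rfloor> * int N \<and> p y - p x - \<lfloor>y - x\<rfloor> * int N \<le> real N * \<alpha>"
    using cyclic_placement_rational[OF assms, of "Suc N\<^sub>0"]
      cyclic_placement_irrational[OF assms, of "Suc N\<^sub>0"] by metis
  define q where "q x = nat (p x mod int N)" for x
  have q: "int (q x) = p x mod int N" for x using N by (simp add: q_def)
  have "\<exists>j. 1 \<le> j \<and> real j \<le> real N * \<alpha> \<and> q y = (q x + j) mod N"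
    if xy: "x \<in> S" "y \<in> S" "0 < frac (y - x)" "frac (y - x) \<le> \<alpha>" for x y :: real
  proof -
    define j where "j = nat (p y - p x - \<lfloor>y - x\<rfloor> * int N)"
    have j: "int j = p y - p x - \<lfloor>y - x\<rfloor> * int N" using p[OF xy] by (simp add: j_def)
    have "int ((q x + j) mod N) = (p x + int j) mod int N"
      by (simp add: zmod_int q mod_simps)
    also have "\<dots> = p y mod int N"
      unfolding j by (simp add: algebra_simps) (metis mod_mult_self2 diff_conv_add_uminus mult_minus_right)
    finally have "q y = (q x + j) mod N" using q by (metis of_nat_eq_iff)
    moreover have "real j \<le> real N * \<alpha>" "1 \<le> j" using p[OF xy] j by linarith+
    ultimately show ?thesis by blast
  qed
  moreover have "q x < N" for x using N by (simp add: q_def nat_less_iff)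
  ultimately show thesis using that[of N q] N by auto
qed

section \<open>From cycles to the circle and back\<close>

lemma ccw_angle_cis:
  "ccw_angle (cis (2 * pi * s)) (cis (2 * pi * t)) = 2 * pi * frac (t - s)"
proof -
  have "cis (2 * pi * (t - s)) = cis (2 * pi * frac (t - s))"
    using cis_multiple_2pi[of "of_int \<lfloor>t - s\<rfloor>"]
    by (simp add: frac_def right_diff_distrib cis_divide[symmetric])
  then have "cis (2 * pi * t) / cis (2 * pi * s) = cis (2 * pi * frac (t - s))"
    by (simp add: cis_divide right_diff_distrib)
  then show ?thesis
    unfolding ccw_angle_def using frac_lt_1[of "t - s"]
    by (intro Arg2pi_unique[of 1]) (auto simp: cis_conv_exp)
qed

lemma circle_rel_iff_real:
  "circle_rel M n r R \<longleftrightarrow> (\<exists>b :: real \<Rightarrow> 'a list. (\<forall>t. b t \<in> tuples M n) \<and>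
     (\<forall>s t. 0 < frac (t - s) \<and> frac (t - s) \<le> 1 / r \<longrightarrow> R (b s) (b t)))"
  for M :: "('f, 'p, 'a) struct"
proof
  assume "circle_rel M n r R"
  then obtain a where a: "\<And>\<theta>. \<theta> \<in> sphere 0 1 \<Longrightarrow> a \<theta> \<in> tuples M n"
    "\<And>\<theta> \<psi>. \<theta> \<in> sphere 0 1 \<Longrightarrow> \<psi> \<in> sphere 0 1 \<Longrightarrow> \<theta> \<noteq> \<psi> \<Longrightarrow> 0 < ccw_angle \<theta> \<psi> \<Longrightarrow>
      ccw_angle \<theta> \<psi> \<le> 2 * pi / r \<Longrightarrow> R (a \<theta>) (a \<psi>)"
    unfolding circle_rel_def by blast
  have "R (a (cis (2 * pi * s))) (a (cis (2 * pi * t)))"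
    if st: "0 < frac (t - s)" "frac (t - s) \<le> 1 / r" for s t
  proof (rule a(2))
    show "0 < ccw_angle (cis (2 * pi * s)) (cis (2 * pi * t))"
      using st by (simp add: ccw_angle_cis)
    then show "cis (2 * pi * s) \<noteq> cis (2 * pi * t)"
      by (auto simp: ccw_angle_def Arg2pi_of_real[of 1, simplified])
    have "2 * pi * frac (t - s) \<le> 2 * pi * (1 / r)"
      using st by (intro mult_left_mono) auto
    then show "ccw_angle (cis (2 * pi * s)) (cis (2 * pi * t)) \<le> 2 * pi / r"
      by (simp add: ccw_angle_cis)
  qed auto
  then show "\<exists>b :: real \<Rightarrow> 'a list. (\<forall>t. b t \<in> tuples M n) \<and>
     (\<forall>s t. 0 < frac (t - s) \<and> frac (t - s) \<le> 1 / r \<longrightarrow> R (b s) (b t))"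
    using a(1) by (intro exI[of _ "\<lambda>t. a (cis (2 * pi * t))"]) auto
next
  assume "\<exists>b :: real \<Rightarrow> 'a list. (\<forall>t. b t \<in> tuples M n) \<and>
     (\<forall>s t. 0 < frac (t - s) \<and> frac (t - s) \<le> 1 / r \<longrightarrow> R (b s) (b t))"
  then obtain b :: "real \<Rightarrow> 'a list" where b: "\<And>t. b t \<in> tuples M n"
    "\<And>s t. 0 < frac (t - s) \<Longrightarrow> frac (t - s) \<le> 1 / r \<Longrightarrow> R (b s) (b t)" by blast
  define \<tau> where "\<tau> \<theta> = Arg2pi \<theta> / (2 * pi)" for \<theta>
  have \<tau>: "cis (2 * pi * \<tau> \<theta>) = \<theta>" if "\<theta> \<in> sphere 0 1" for \<theta>
    using that complex_norm_eq_1_exp[of \<theta>] by (simp add: \<tau>_def cis_conv_exp)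
  have "R (b (\<tau> \<theta>)) (b (\<tau> \<psi>))" if *: "\<theta> \<in> sphere 0 1" "\<psi> \<in> sphere 0 1"
    "0 < ccw_angle \<theta> \<psi>" "ccw_angle \<theta> \<psi> \<le> 2 * pi / r" for \<theta> \<psi>
  proof -
    have "ccw_angle \<theta> \<psi> = 2 * pi * frac (\<tau> \<psi> - \<tau> \<theta>)"
      using ccw_angle_cis[of "\<tau> \<theta>" "\<tau> \<psi>"] \<tau> * by simp
    then have "0 < 2 * pi * frac (\<tau> \<psi> - \<tau> \<theta>)" "2 * pi * frac (\<tau> \<psi> - \<tau> \<theta>) \<le> 2 * pi * (1 / r)"
      using * by simp_all
    then have "0 < frac (\<tau> \<psi> - \<tau> \<theta>)" "frac (\<tau> \<psi> - \<tau> \<theta>) \<le> 1 / r"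
      using pi_gt_zero by (simp add: zero_less_mult_iff, metis mult_le_cancel_left_pos mult_pos_pos zero_less_numeral)
    then show ?thesis by (rule b(2))
  qed
  then show "circle_rel M n r R"
    unfolding circle_rel_def using b(1) by (intro exI[of _ "\<lambda>\<theta>. b (\<tau> \<theta>)"]) auto
qed

text \<open>
  Restrict to \<open>N\<close> equidistant points. The bound \<open>r \<ge> 3\<close> ensures \<open>j < N\<close>, so that \<open>j\<close> steps
  make an arc of length \<open>j / N\<close> less than a full turn.
\<close>

lemma circle_imp_cyclic:
  assumes "r \<ge> 3" "circle_rel M n r R"
  shows "cyclic_rel M n r N R"
proof -
  obtain b where b: "\<And>t. b t \<in> tuples M n"
    "\<And>s t. 0 < frac (t - s) \<Longrightarrow> frac (t - s) \<le> 1 / r \<Longrightarrow> R (b s) (b t)"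
    using assms(2) unfolding circle_rel_iff_real by blast
  have "R (b (real i / real N)) (b (real ((i + j) mod N) / real N))"
    if ij: "i < N" "1 \<le> j" "real j \<le> real N / r" for i j
  proof -
    have "real N / r \<le> real N / 3"
      using assms(1) by (intro divide_left_mono) auto
    then have j: "j < N" using ij by linarith
    have "real ((i + j) mod N) = real (i + j) - real N * real ((i + j) div N)"
      by (metis add_diff_cancel_right' mult.commute mod_mult_div_eq of_nat_add of_nat_mult)
    then have "real ((i + j) mod N) / real N - real i / real N
        = real j / real N + real_of_int (- int ((i + j) div N))"
      using ij by (simp add: field_simps)
    then have f: "frac (real ((i + j) mod N) / real N - real i / real N) = real j / real N"
      using j by (simp only: frac_add_of_int_right) (simp add: frac_eq)
    show ?thesis
      by (rule b(2); unfold f) (use ij assms(1) in \<open>simp_all add: field_simps\<close>)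
  qed
  then show ?thesis
    unfolding cyclic_rel_def using b(1) by (intro exI[of _ "\<lambda>i. b (real i / real N)"]) auto
qed


text \<open>
  The unknowns are the \<open>n\<close> coordinates of a tuple for each real number, and one for each
  parameter of the formula defining \<open>R\<close>. Finitely many of the required relations involve finitely
  many points, which are placed on a long cycle.
\<close>

lemma large_cyclic_imp_circle:
  fixes M :: "('f, 'p, 'a) struct"
  assumes "r > 0" and sat: "saturated L M \<kappa>" and ne: "univ M \<noteq> {}"
    and \<kappa>: "|UNIV :: real set| <o \<kappa>" and def: "definable_rel L M n R"
    and cyc: "\<And>N. N \<ge> N\<^sub>0 \<Longrightarrow> cyclic_rel M n r N R"
  shows "circle_rel M n r R"
proof -
  obtain \<phi> cs where \<phi>: "wf_fm L \<phi>" "set cs \<subseteq> univ M" "fv \<phi> \<subseteq> {..<n + n + length cs}"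
    "\<And>a b. a \<in> tuples M n \<Longrightarrow> b \<in> tuples M n \<Longrightarrow> R a b \<longleftrightarrow> sat M (env (a @ b @ cs)) \<phi>"
    using def unfolding definable_rel_def by blast
  define e :: "real \<times> real \<Rightarrow> nat \<Rightarrow> real \<times> nat + nat" where
    "e = (\<lambda>(s, t) k. if k < n then Inl (s, k) else if k < n + n then Inl (t, k - n) else Inr (k - (n + n)))"
  define P where "P = {(s, t). 0 < frac (t - s) \<and> frac (t - s) \<le> 1 / r}"
  define F\<^sub>0 :: "((real \<times> nat + nat) \<times> 'a) set" where
    "F\<^sub>0 = (\<lambda>j. (Inr j, cs ! j)) ` {..<length cs}"
  define tup :: "(real \<times> nat + nat \<Rightarrow> 'a) \<Rightarrow> real \<Rightarrow> 'a list" where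
    "tup g t = map (\<lambda>k. g (Inl (t, k))) [0..<n]" for g t
  have tup: "tup g t \<in> tuples M n" if "range g \<subseteq> univ M" for g t
    using that by (auto simp: tup_def tuples_def)
  have sat_iff: "sat M (\<lambda>k. g (e (s, t) k)) \<phi> \<longleftrightarrow> R (tup g s) (tup g t)"
    if "range g \<subseteq> univ M" "\<And>j. j < length cs \<Longrightarrow> g (Inr j) = cs ! j" for g s t
    unfolding \<phi>(4)[OF tup[OF that(1)] tup[OF that(1)]]
    by (rule sat_cong) (use \<phi>(3) that(2) in \<open>force simp: e_def env_def tup_def nth_append\<close>)
  have "\<exists>g. solves M ((\<lambda>p. (\<phi>, e p)) ` P) F\<^sub>0 g"
  proof (rule saturated_realizes[OF sat ne])
    have "|UNIV :: (real \<times> nat + nat) set| \<le>o |UNIV :: real set|"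
    proof -
      have inf: "\<not> finite (Field |UNIV :: real set| )" unfolding Field_card_of by (rule infinite_UNIV_char_0)
      have nat: "|UNIV :: nat set| \<le>o |UNIV :: real set|"
        using infinite_iff_card_of_nat infinite_UNIV_char_0 by blast
      show ?thesis
        unfolding UNIV_Plus_UNIV[symmetric] UNIV_Times_UNIV[symmetric]
        by (intro card_of_Plus_ordLeq_infinite_Field card_of_Times_ordLeq_infinite_Field inf nat
            card_of_Card_order ordLeq_refl)
    qed
    then show "|UNIV :: (real \<times> nat + nat) set| <o \<kappa>"
      using \<kappa> by (rule ordLeq_ordLess_trans)
    show "wf_fm L \<psi>" if "(\<psi>, f) \<in> (\<lambda>p. (\<phi>, e p)) ` P" for \<psi> f
      using that \<phi>(1) by auto
    fix \<Gamma>' assume "\<Gamma>' \<subseteq> (\<lambda>p. (\<phi>, e p)) ` P" "finite \<Gamma>'"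
    then obtain Q where Q: "Q \<subseteq> P" "finite Q" "\<Gamma>' = (\<lambda>p. (\<phi>, e p)) ` Q"
      by (meson finite_subset_image)
    have "finite (fst ` Q \<union> snd ` Q)" "0 < 1 / r" using Q(2) assms(1) by auto
    then obtain N and q :: "real \<Rightarrow> nat" where N: "N \<ge> N\<^sub>0" "\<And>x. q x < N"
      "\<And>x y. x \<in> fst ` Q \<union> snd ` Q \<Longrightarrow> y \<in> fst ` Q \<union> snd ` Q \<Longrightarrow> 0 < frac (y - x) \<Longrightarrow> frac (y - x) \<le> 1 / r \<Longrightarrow>
         \<exists>j. 1 \<le> j \<and> real j \<le> real N * (1 / r) \<and> q y = (q x + j) mod N"
      by (rule cyclic_placement[where N\<^sub>0 = N\<^sub>0]) (rule that)
    obtain b where b: "\<And>i. i < N \<Longrightarrow> b i \<in> tuples M n"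
      "\<And>i j. i < N \<Longrightarrow> 1 \<le> j \<Longrightarrow> real j \<le> real N / r \<Longrightarrow> R (b i) (b ((i + j) mod N))"
      using cyc[OF N(1)] unfolding cyclic_rel_def by blast
    obtain d where d: "d \<in> univ M" using ne by blast
    define g where "g w = (case w of Inl (t, k) \<Rightarrow> if k < n then b (q t) ! k else d
      | Inr j \<Rightarrow> if j < length cs then cs ! j else d)" for w
    have b': "length (b (q t)) = n" "set (b (q t)) \<subseteq> univ M" for t
      using b(1)[OF N(2)] by (auto simp: tuples_def)
    have b_univ: "b (q t) ! k \<in> univ M" if "k < n" for t k
      using that b'(1)[of t] b'(2)[of t] nth_mem by blast
    have tup_g: "tup g t = b (q t)" for t
      by (rule nth_equalityI) (simp_all add: tup_def g_def b')
    have g: "range g \<subseteq> univ M" "\<And>j. j < length cs \<Longrightarrow> g (Inr j) = cs ! j"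
      using d b_univ \<phi>(2) by (auto simp: g_def subset_iff split: sum.splits)
    have "R (b (q s)) (b (q t))" if st: "(s, t) \<in> Q" for s t
    proof -
      have "0 < frac (t - s)" "frac (t - s) \<le> 1 / r" using st Q(1) by (auto simp: P_def)
      moreover have "s \<in> fst ` Q \<union> snd ` Q" "t \<in> fst ` Q \<union> snd ` Q" using st by force+
      ultimately obtain j where "1 \<le> j" "real j \<le> real N * (1 / r)" "q t = (q s + j) mod N"
        using N(3) by metis
      then show ?thesis using b(2)[OF N(2), of j s] by simp
    qed
    then have "solves M \<Gamma>' F\<^sub>0 g"
      using g sat_iff[OF g] tup_g unfolding solves_def Q(3) F\<^sub>0_def by auto
    then show "\<exists>g. solves M \<Gamma>' F\<^sub>0 g" by blast
  qed
  then obtain g where "solves M ((\<lambda>p. (\<phi>, e p)) ` P) F\<^sub>0 g" by blast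
  then have g: "range g \<subseteq> univ M" "\<And>j. j < length cs \<Longrightarrow> g (Inr j) = cs ! j"
    "\<And>s t. (s, t) \<in> P \<Longrightarrow> sat M (\<lambda>k. g (e (s, t) k)) \<phi>"
    unfolding solves_def F\<^sub>0_def by auto
  then have "R (tup g s) (tup g t)" if "(s, t) \<in> P" for s t
    using sat_iff[OF g(1,2)] that by blast
  then show ?thesis
    unfolding circle_rel_iff_real using tup[OF g(1)] unfolding P_def by blast
qed

theorem mainTheorem4:
  fixes r :: real
    and L :: "('f, 'p) lang"
    and T :: "('f, 'p) fm set"
    and M :: "('f, 'p, 'a) struct"
    and \<kappa> :: "'k rel"
  assumes "r \<ge> 3"
    and "complete_theory L T"
    and "is_model L M T"
    and "Card_order \<kappa>" and "|UNIV :: real set| <o \<kappa>"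
    and "saturated L M \<kappa>"
  shows "(cond_all_cycles L M r \<longleftrightarrow> cond_large_cycles L M r) \<and>
         (cond_large_cycles L M r \<longleftrightarrow> cond_circle L M r)"
proof -
  have ne: "univ M \<noteq> {}" using assms(3) by (simp add: is_model_def is_struct_def)
  have "cond_all_cycles L M r \<Longrightarrow> cond_large_cycles L M r"
    unfolding cond_all_cycles_def cond_large_cycles_def by blast
  moreover have "cond_large_cycles L M r \<Longrightarrow> cond_circle L M r"
    unfolding cond_large_cycles_def cond_circle_def
    using large_cyclic_imp_circle[OF _ assms(6) ne assms(5)] assms(1) by fastforce
  moreover have "cond_circle L M r \<Longrightarrow> cond_all_cycles L M r"
    unfolding cond_circle_def cond_all_cycles_def using circle_imp_cyclic[OF assms(1)] by blast
  ultimately show ?thesis by blast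
qed

end
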